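(* For monic polynomials $h,f\in A=\mathbb{F}_q[X]$ define $$\eta(h,f)=\sum_{\substack{g \bmod f\\ (g,f)=1}}\varepsilon(hg,f),$$ where the sum runs over the residue classes $g$ modulo $f$ that are coprime to $f$, and $\varepsilon$ is the additive character defined in the context. Then $$\eta(h,f)=\sum_{d\mid (h,f)}|d|\,\mu\left(\frac{f}{d}\right).$$
   Context: $A=\mathbb{F}_q[X]$ is the polynomial ring over the finite field with $q=p^t$ elements, $p$ prime, $t\ge 1$. For nonzero $f\in A$, $|f|=q^{\deg f}$. $(a,b)$ denotes the monic greatest common divisor, and sums over $d\mid n$ run over the monic divisors $d$ of $n$. The Möbius function $\mu$ is defined by $\mu(f)=0$ if $f$ is not squarefree and $\mu(f)=(-1)^k$ if $f$ is a nonzero constant times a product of $k$ distinct monic irreducibles (so $\mu(1)=1$). Definition of $\varepsilon$: let $f\in A$ be monic of degree $r$ and let $h\in A$. Write $h\equiv \alpha_1X^{r-1}+\dots+\alpha_r \pmod f$ with $\alpha_i\in\mathbb{F}_q$, i.e. $\alpha_1$ is the coefficient of $X^{r-1}$ in the remainder of $h$ modulo $f$ (if $r=0$ the remainder is $0$ and $\alpha_1=0$). If $t=1$, so $q=p$, put $\varepsilon(h,f)=\exp(2\pi i\alpha_1/p)$. If $t>1$, fix a presentation $\mathbb{F}_q=\mathbb{F}_p(\theta)$ where $\theta$ is a root of an irreducible polynomial $\Psi(X)=X^t+c_1X^{t-1}+\dots+c_t\in\mathbb{F}_p[X]$; write $\alpha_1=a_1\theta^{t-1}+\dots+a_t$ with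 $a_i\in\mathbb{F}_p$, and put $\varepsilon(h,f)=\exp(2\pi i a_1/p)$. (Elements of $\mathbb{F}_p$ are represented by integers in the exponent.) $\varepsilon(h,f)$ depends only on $h$ modulo $f$. *)

theory Defs
  imports Complex_Main "HOL-Computational_Algebra.Computational_Algebra" "HOL-Library.Cardinality"
begin

(* The library gcd on polynomials requires a coefficient type of class field_gcd, which an
   arbitrary finite field type need not be.  This is the gcd over any field. *)
definition monic_gcd :: "'a::field poly \<Rightarrow> 'a poly \<Rightarrow> 'a poly" where
  "monic_gcd a b =
     (THE d. lead_coeff d = 1 \<and> d dvd a \<and> d dvd b \<and> (\<forall>e. e dvd a \<longrightarrow> e dvd b \<longrightarrow> e dvd d))"

(* only meant for nonzero f *)
definition poly_abs :: "'a::{finite,field} poly \<Rightarrow> nat" where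
  "poly_abs f = CARD('a) ^ degree f"

definition moebius :: "'a::field poly \<Rightarrow> int" where
  "moebius f =
     (if squarefree f then (-1) ^ card {P. lead_coeff P = 1 \<and> irreducible P \<and> P dvd f} else 0)"

(* F_p as a subfield of a field of characteristic p *)
definition prime_field :: "'a::field set" where
  "prime_field = range of_int"

(* F_p[X] as a subring of F_q[X] *)
definition prime_field_polys :: "'a::field poly set" where
  "prime_field_polys = {P. \<forall>i. coeff P i \<in> prime_field}"

(* Irreducibility in a subring R: the library's irreducible, with units and factors taken in R.
   A polynomial that is irreducible in F_p[X] need not be irreducible in F_q[X]. *)
definition irreducible_in :: "'a::comm_ring_1 set \<Rightarrow> 'a \<Rightarrow> bool" where
  "irreducible_in R P \<longleftrightarrow>
     P \<in> R \<and> P \<noteq> 0 \<and> \<not> (\<exists>u\<in>R. P * u = 1) \<and>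
     (\<forall>a\<in>R. \<forall>b\<in>R. P = a * b \<longrightarrow> (\<exists>u\<in>R. a * u = 1) \<or> (\<exists>u\<in>R. b * u = 1))"

(* F_p(theta) *)
definition prime_field_adjoin :: "'a::field \<Rightarrow> 'a set" where
  "prime_field_adjoin \<theta> =
     {poly a \<theta> / poly b \<theta> | a b.
        a \<in> prime_field_polys \<and> b \<in> prime_field_polys \<and> poly b \<theta> \<noteq> 0}"

definition presentation :: "nat \<Rightarrow> 'a::field \<Rightarrow> 'a poly \<Rightarrow> bool" where
  "presentation t \<theta> \<Psi> \<longleftrightarrow>
     irreducible_in prime_field_polys \<Psi> \<and> lead_coeff \<Psi> = 1 \<and> degree \<Psi> = t \<and> poly \<Psi> \<theta> = 0 \<and>
     prime_field_adjoin \<theta> = UNIV"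

(* The coefficient a_1 of theta^(t-1) in alpha = a_1 theta^(t-1) + ... + a_t with a_i in F_p. *)
definition theta_coord :: "nat \<Rightarrow> 'a::field \<Rightarrow> 'a \<Rightarrow> 'a" where
  "theta_coord t \<theta> \<alpha> =
     (THE x. \<exists>a :: nat \<Rightarrow> 'a. (\<forall>i\<in>{1..t}. a i \<in> prime_field) \<and>
        \<alpha> = (\<Sum>i=1..t. a i * \<theta> ^ (t - i)) \<and> x = a 1)"

definition int_rep :: "nat \<Rightarrow> 'a::field \<Rightarrow> int" where
  "int_rep p x = (THE k. 0 \<le> k \<and> k < int p \<and> of_int k = x)"

(* For degree f = 0 (f monic) the remainder is 0, so the truncated index 0 yields alpha_1 = 0. *)
definition alpha1 :: "'a::field poly \<Rightarrow> 'a poly \<Rightarrow> 'a" where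
  "alpha1 h f = coeff (h mod f) (degree f - 1)"

definition eps :: "nat \<Rightarrow> nat \<Rightarrow> 'a::field \<Rightarrow> 'a poly \<Rightarrow> 'a poly \<Rightarrow> complex" where
  "eps p t \<theta> h f =
     (let a1 = (if t = 1 then alpha1 h f else theta_coord t \<theta> (alpha1 h f))
      in exp (2 * of_real pi * \<i> * of_int (int_rep p a1) / of_nat p))"

(* Residue classes modulo f are represented by the reduced polynomials g, i.e. g mod f = g;
   for f = 1 this is the single class of 0, which is coprime to 1. *)
definition eta :: "nat \<Rightarrow> nat \<Rightarrow> 'a::{finite,field} \<Rightarrow> 'a poly \<Rightarrow> 'a poly \<Rightarrow> complex" where
  "eta p t \<theta> h f = (\<Sum>g | g mod f = g \<and> coprime g f. eps p t \<theta> (h * g) f)"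

end

theory Submission
  imports Defs "HOL-Number_Theory.Cong"
begin

text \<open>
  Write \<open>\<psi>\<close> for the map that sends \<open>\<alpha>\<close> in \<open>F\<^sub>q\<close> to the root of unity attached to the leading coordinate of
  \<open>\<alpha>\<close>, so that \<open>\<epsilon>(h, f) = \<psi>(\<alpha>\<^sub>1)\<close> where \<open>\<alpha>\<^sub>1\<close> is the top coefficient of the remainder of \<open>h\<close>. All that
  matters about \<open>\<psi>\<close> is that it is a nontrivial character of the additive group of \<open>F\<^sub>q\<close>; the formula
  then follows as for the classical Ramanujan sum.

  \<^item> The map \<open>g \<mapsto> \<epsilon>(h g, f)\<close> is an additive character modulo \<open>f\<close>. If \<open>f\<close> divides \<open>h\<close> it is trivial;
    otherwise some monomial \<open>g\<close> moves the leading term of \<open>h mod f\<close> to the top position, and a suitable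
    scalar gives it a value other than \<open>1\<close>. So its sum over all residues is \<open>|f|\<close> or \<open>0\<close>
    (\<open>sum_residues\<close>).
  \<^item> Since \<open>e\<close> is monic, multiplication by \<open>e\<close> shifts the remainder without changing its top coefficient,
    so \<open>\<epsilon>(e h, e d) = \<epsilon>(h, d)\<close>. Therefore the sum over those residues modulo \<open>f = e d\<close> that are multiples
    of \<open>e\<close> is the full sum modulo \<open>d\<close> (\<open>sum_residues_multiples\<close>).
  \<^item> The coprimality condition is detected by \<open>\<Sum> \<mu>(e)\<close>, over the monic \<open>e\<close> dividing both \<open>f\<close> and \<open>g\<close>
    (\<open>sum_moebius_common_divisors\<close>). Exchanging the sums and putting \<open>d = f / e\<close> gives the theorem
    (\<open>sum_coprime_residues\<close>).

  It remains to see that \<open>\<psi>\<close> is a nontrivial character, that is, that the leading coordinate is additive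
  and takes the value \<open>1\<close>. For this the powers of \<open>\<theta>\<close> have to form a basis over the prime field. They
  span, because quotients of polynomials in \<open>\<theta>\<close> are polynomials in \<open>\<theta>\<close> (inverses in a finite field are
  powers) and these can be reduced modulo \<open>\<Psi>\<close>; they are independent because there are just
  \<open>p ^ t = q\<close> coefficient vectors for the \<open>q\<close> field elements.
\<close>

section \<open>Monic divisors and the greatest common divisor\<close>

lemma monic_imp_nonzero: "lead_coeff (f :: 'a::field poly) = 1 \<Longrightarrow> f \<noteq> 0"
  by auto

lemma monic_dvd_antisym:
  fixes a b :: "'a::field poly"
  assumes "lead_coeff a = 1" "lead_coeff b = 1" "a dvd b" "b dvd a"
  shows "a = b"
proof -
  obtain u where u: "b = a * u" using assms(3) by (elim dvdE)
  have "u dvd 1" using assms u monic_imp_nonzero[OF assms(1)]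
    by (metis dvd_times_left_cancel_iff mult.right_neutral)
  then obtain c where c: "u = [:c:]" by (auto simp: is_unit_poly_iff)
  have "lead_coeff b = lead_coeff a * lead_coeff u" by (simp add: u lead_coeff_mult)
  with c assms show ?thesis by (simp add: u)
qed

lemma monic_cofactor:
  fixes d e :: "'a::field poly"
  assumes "lead_coeff (d * e) = 1" "lead_coeff d = 1"
  shows "lead_coeff e = 1"
  using assms by (simp add: lead_coeff_mult)

lemma exists_monic_associate:
  fixes P :: "'a::field poly"
  assumes "P \<noteq> 0"
  obtains Q where "lead_coeff Q = 1" "Q dvd P" "P dvd Q"
proof
  let ?Q = "smult (inverse (lead_coeff P)) P"
  show "lead_coeff ?Q = 1" using assms by simp
  show "?Q dvd P" using assms by (simp add: smult_dvd_iff)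
  show "P dvd ?Q" by (rule dvd_smult) simp
qed

text \<open>
  Bezout's identity over any field: a nonzero element of least degree in the ideal generated by
  \<open>a\<close> and \<open>b\<close> divides every element of that ideal, since the remainder lies in the ideal too.
\<close>

lemma exists_common_divisor_combination:
  fixes a b :: "'a::field poly"
  assumes "b \<noteq> 0"
  obtains d u v where "lead_coeff d = 1" "d dvd a" "d dvd b" "d = u * a + v * b"
proof -
  define I where "I = {u * a + v * b | u v. True}"
  have "\<exists>w. w \<in> I \<and> w \<noteq> 0"
    using assms unfolding I_def
    by (intro exI[of _ b]) (auto intro: exI[of _ "0 :: 'a poly"] exI[of _ "1 :: 'a poly"])
  then obtain w where w: "w \<in> I" "w \<noteq> 0"
      and least: "\<And>x. x \<in> I \<Longrightarrow> x \<noteq> 0 \<Longrightarrow> degree w \<le> degree x"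
    using exists_least_iff[of "\<lambda>n. \<exists>x. x \<in> I \<and> x \<noteq> 0 \<and> degree x = n"]
    by (metis not_le_imp_less)
  obtain r s where rs: "w = r * a + s * b" using w by (auto simp: I_def)
  have dvd: "w dvd x" if x: "x \<in> I" for x
  proof -
    obtain u v where "x = u * a + v * b" using x by (auto simp: I_def)
    then have "x mod w = (u - x div w * r) * a + (v - x div w * s) * b"
      by (simp add: minus_div_mult_eq_mod[symmetric] algebra_simps)
         (simp add: rs algebra_simps)
    then have "x mod w \<in> I" by (auto simp: I_def)
    then show ?thesis
      using least[of "x mod w"] degree_mod_less[OF w(2), of x] by (force simp: dvd_eq_mod_eq_0)
  qed
  have "a = 1 * a + 0 * b" "b = 0 * a + 1 * b" by simp_all
  then have "a \<in> I" "b \<in> I" unfolding I_def by blast+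
  then have w_dvd: "w dvd a" "w dvd b" using dvd by auto
  obtain d where d: "lead_coeff d = 1" "d dvd w" "w dvd d"
    using exists_monic_associate[OF w(2)] .
  then obtain k where "d = w * k" by (elim dvdE)
  then have "d = (k * r) * a + (k * s) * b" by (simp add: rs algebra_simps)
  then show ?thesis using that d w_dvd dvd_trans by blast
qed

lemma monic_gcd_properties:
  fixes a b :: "'a::field poly"
  assumes "b \<noteq> 0"
  shows lead_coeff_monic_gcd: "lead_coeff (monic_gcd a b) = 1"
    and dvd_monic_gcd_iff: "e dvd monic_gcd a b \<longleftrightarrow> e dvd a \<and> e dvd b"
proof -
  obtain d u v where d: "lead_coeff d = 1" "d dvd a" "d dvd b" "d = u * a + v * b"
    using exists_common_divisor_combination[OF assms] .
  have greatest: "e dvd d" if "e dvd a" "e dvd b" for e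
    unfolding d(4) using that by simp
  have "monic_gcd a b = d" unfolding monic_gcd_def
  proof (rule the_equality)
    show "lead_coeff d = 1 \<and> d dvd a \<and> d dvd b \<and> (\<forall>e. e dvd a \<longrightarrow> e dvd b \<longrightarrow> e dvd d)"
      using d(1-3) greatest by blast
  next
    fix c assume c: "lead_coeff c = 1 \<and> c dvd a \<and> c dvd b \<and> (\<forall>e. e dvd a \<longrightarrow> e dvd b \<longrightarrow> e dvd c)"
    then have "c dvd d" "d dvd c" using d(2,3) greatest by auto
    then show "c = d" using monic_dvd_antisym c d(1) by blast
  qed
  moreover have "e dvd d \<longleftrightarrow> e dvd a \<and> e dvd b"
    using greatest d(2,3) dvd_trans by blast
  ultimately show "lead_coeff (monic_gcd a b) = 1" "e dvd monic_gcd a b \<longleftrightarrow> e dvd a \<and> e dvd b"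
    using d(1) by simp_all
qed

section \<open>Residue systems\<close>

lemma reduced_iff_coeff:
  fixes f g :: "'a::field poly"
  assumes "f \<noteq> 0"
  shows "g mod f = g \<longleftrightarrow> (\<forall>i\<ge>degree f. coeff g i = 0)"
proof
  assume g: "g mod f = g"
  show "\<forall>i\<ge>degree f. coeff g i = 0"
    using degree_mod_less[OF assms, of g] unfolding g by (auto intro: coeff_eq_0)
next
  assume g: "\<forall>i\<ge>degree f. coeff g i = 0"
  show "g mod f = g"
  proof (cases "g = 0")
    case False
    then have "degree g < degree f" using g by (metis leading_coeff_0_iff not_le)
    then show ?thesis by (rule mod_poly_less)
  qed simp
qed

text \<open>
  Bounding the degree through vanishing coefficients, rather than by an inequality for
  \<^const>\<open>degree\<close>, makes \<open>n = 0\<close> describe the zero polynomial alone. This fits the modulus \<open>1\<close>, whose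
  only residue is \<open>0\<close>.
\<close>

lemma card_polys_bounded_degree:
  "card {g :: 'a::{finite,field} poly. \<forall>i\<ge>n. coeff g i = 0} = CARD('a) ^ n"
  "finite {g :: 'a::{finite,field} poly. \<forall>i\<ge>n. coeff g i = 0}"
proof (induction n)
  case 0
  have "{g :: 'a poly. \<forall>i\<ge>0. coeff g i = 0} = {0}" by (auto simp: poly_eq_iff)
  then show "card {g :: 'a poly. \<forall>i\<ge>0. coeff g i = 0} = CARD('a) ^ 0"
    "finite {g :: 'a poly. \<forall>i\<ge>0. coeff g i = 0}" by simp_all
next
  case (Suc n)
  let ?R = "\<lambda>n. {g :: 'a poly. \<forall>i\<ge>n. coeff g i = 0}"
  have eq: "?R (Suc n) = (\<lambda>(a, g). pCons a g) ` (UNIV \<times> ?R n)"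
  proof (intro equalityI subsetI)
    fix g assume g: "g \<in> ?R (Suc n)"
    obtain a g' where g': "g = pCons a g'" by (cases g)
    have "coeff g' i = 0" if "i \<ge> n" for i
      using g that unfolding g' by (auto dest!: spec[of _ "Suc i"])
    then show "g \<in> (\<lambda>(a, g). pCons a g) ` (UNIV \<times> ?R n)" using g' by auto
  qed (auto simp: coeff_pCons split: nat.splits)
  have inj: "inj_on (\<lambda>(a, g). pCons a g) (UNIV \<times> ?R n)" by (auto simp: inj_on_def)
  show "card (?R (Suc n)) = CARD('a) ^ Suc n"
    unfolding eq by (subst card_image[OF inj]) (simp add: card_cartesian_product Suc.IH)
  show "finite (?R (Suc n))" unfolding eq by (intro finite_imageI finite_cartesian_product) (use Suc in auto)
qed

lemma card_residues:
  fixes f :: "'a::{finite,field} poly"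
  assumes "f \<noteq> 0"
  shows "card {g. g mod f = g} = poly_abs f" "finite {g. g mod f = g}"
  by (simp_all add: reduced_iff_coeff[OF assms] card_polys_bounded_degree poly_abs_def)

lemma finite_divisors_poly:
  fixes f :: "'a::{finite,field} poly"
  assumes "f \<noteq> 0"
  shows "finite {d. d dvd f}"
proof (rule finite_subset)
  show "{d. d dvd f} \<subseteq> {d. \<forall>i\<ge>Suc (degree f). coeff d i = 0}"
    using dvd_imp_degree_le[OF _ assms] by (fastforce intro: coeff_eq_0)
qed (rule card_polys_bounded_degree)

section \<open>The Moebius function\<close>

lemma exists_monic_irreducible_factor:
  fixes n :: "'a::field poly"
  assumes "lead_coeff n = 1" "n \<noteq> 1"
  obtains P where "lead_coeff P = 1" "irreducible P" "P dvd n"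
proof -
  have unit: "\<not> n dvd 1" using assms monic_dvd_antisym[of n 1] by auto
  have "\<exists>P. irreducible P \<and> P dvd n"
    using unit monic_imp_nonzero[OF assms(1)]
  proof (induction "degree n" arbitrary: n rule: less_induct)
    case less
    show ?case
    proof (cases "irreducible n")
      case False
      then obtain a b where ab: "n = a * b" "\<not> a dvd 1" "\<not> b dvd 1"
        using less.prems by (auto simp: irreducible_def)
      then have "a \<noteq> 0" "b \<noteq> 0" using less.prems by auto
      then have "degree a < degree n" using ab
        by (auto simp: degree_mult_eq is_unit_iff_degree)
      then show ?thesis using less.hyps[of a] ab \<open>a \<noteq> 0\<close> by (auto intro: dvd_mult2)
    qed auto
  qed
  then obtain P where P: "irreducible P" "P dvd n" by blast
  then have "P \<noteq> 0" by auto
  then obtain Q where Q: "lead_coeff Q = 1" "Q dvd P" "P dvd Q"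
    using exists_monic_associate by blast
  have "irreducible Q"
  proof (rule irreducibleI)
    show "Q \<noteq> 0" using Q(1) by auto
    show "\<not> Q dvd 1" using P(1) Q(3) irreducible_not_unit dvd_trans by blast
    fix a b assume "Q = a * b"
    then have "P dvd a * b" using Q(3) by simp
    then have "P dvd a \<or> P dvd b"
      using field_poly_irreducible_imp_prime[OF P(1)] by (simp add: prime_elem_dvd_mult_iff)
    then have "a * b dvd a \<or> a * b dvd b"
      using Q(2) \<open>Q = a * b\<close> dvd_trans by blast
    then have "a * b dvd a * 1 \<or> a * b dvd 1 * b" by simp
    moreover have "a \<noteq> 0" "b \<noteq> 0" using \<open>Q \<noteq> 0\<close> \<open>Q = a * b\<close> by auto
    ultimately show "a dvd 1 \<or> b dvd 1"
      unfolding dvd_times_left_cancel_iff dvd_times_right_cancel_iff by auto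
  qed
  with Q show ?thesis using that P dvd_trans by blast
qed

lemma finite_monic_irreducible_factors:
  fixes d :: "'a::{finite,field} poly"
  assumes "d \<noteq> 0"
  shows "finite {P. lead_coeff P = 1 \<and> irreducible P \<and> P dvd d}"
  by (rule finite_subset[OF _ finite_divisors_poly[OF assms]]) auto

lemma squarefree_mult_irreducible_iff:
  fixes P d :: "'a::field poly"
  assumes P: "irreducible P" and nd: "\<not> P dvd d"
  shows "squarefree (P * d) \<longleftrightarrow> squarefree d"
proof
  assume "squarefree (P * d)"
  then show "squarefree d" by (rule squarefree_multD)
next
  assume sf: "squarefree d"
  have prime: "prime_elem P" using P by (rule field_poly_irreducible_imp_prime)
  have P0: "P \<noteq> 0" using P by auto
  show "squarefree (P * d)"
  proof (rule squarefreeI)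
    fix x assume x: "x\<^sup>2 dvd P * d"
    have "\<not> P dvd x"
    proof
      assume "P dvd x"
      then have "P * P dvd P * d" using x
        by (metis dvd_trans mult_dvd_mono power2_eq_square)
      then show False using nd P0 by simp
    qed
    moreover obtain y where y: "P * d = x\<^sup>2 * y" using x by (elim dvdE)
    then have "P dvd x\<^sup>2 * y" by (metis dvd_triv_left)
    ultimately have "P dvd y"
      using prime by (auto simp: prime_elem_dvd_mult_iff power2_eq_square)
    then obtain z where "y = P * z" by (elim dvdE)
    then have "d = x\<^sup>2 * z" using y P0 by (simp add: mult.left_commute)
    then have "x\<^sup>2 dvd d" by simp
    with sf show "x dvd 1" by (rule squarefreeD)
  qed
qed

lemma moebius_mult_irreducible:
  fixes P d :: "'a::{finite,field} poly"
  assumes P: "lead_coeff P = 1" "irreducible P" and nd: "\<not> P dvd d"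
  shows "moebius (P * d) = - moebius d"
proof -
  have d0: "d \<noteq> 0" using nd by auto
  let ?S = "\<lambda>d. {Q. lead_coeff Q = 1 \<and> irreducible Q \<and> Q dvd d}"
  have "Q = P" if "lead_coeff Q = 1" "irreducible Q" "Q dvd P" for Q
  proof -
    have "P dvd Q" using that P irreducible_not_unit[of Q] by (metis irreducibleD')
    then show ?thesis using monic_dvd_antisym that P by blast
  qed
  then have "?S (P * d) = insert P (?S d)"
    using P by (auto simp: prime_elem_dvd_mult_iff[OF field_poly_irreducible_imp_prime])
  then have "card (?S (P * d)) = Suc (card (?S d))"
    using nd finite_monic_irreducible_factors[OF d0] by simp
  then show ?thesis
    using squarefree_mult_irreducible_iff[OF P(2) nd] by (simp add: moebius_def)
qed

text \<open>
  Fix a monic irreducible factor \<open>P\<close> of \<open>n \<noteq> 1\<close>. Divisors \<open>d\<close> prime to \<open>P\<close> are paired with \<open>P d\<close>, which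
  again divides \<open>n\<close> and has the opposite sign; all other divisors are multiples of \<open>P\<^sup>2\<close> and contribute
  nothing.
\<close>

lemma sum_moebius_monic_divisors:
  fixes n :: "'a::{finite,field} poly"
  assumes "lead_coeff n = 1"
  shows "(\<Sum>d | lead_coeff d = 1 \<and> d dvd n. moebius d) = (if n = 1 then 1 else 0)"
proof (cases "n = 1")
  case True
  have "{d :: 'a poly. lead_coeff d = 1 \<and> d dvd 1} = {1}"
    using monic_dvd_antisym[of _ 1] by auto
  moreover have "moebius (1 :: 'a poly) = 1"
  proof -
    have "{P :: 'a poly. lead_coeff P = 1 \<and> irreducible P \<and> P dvd 1} = {}"
      using irreducible_not_unit by blast
    then show ?thesis unfolding moebius_def by (simp only: card.empty squarefree_1) simp
  qed
  ultimately show ?thesis using True by simp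
next
  case False
  obtain P where P: "lead_coeff P = 1" "irreducible P" "P dvd n"
    using exists_monic_irreducible_factor[OF assms False] .
  have prime: "prime_elem P" using P by (intro field_poly_irreducible_imp_prime)
  have n0: "n \<noteq> 0" and P0: "P \<noteq> 0" using assms P by auto
  let ?D = "{d. lead_coeff d = 1 \<and> d dvd n}"
  let ?A = "{d \<in> ?D. \<not> P dvd d}"
  let ?B = "{d \<in> ?D. P dvd d \<and> \<not> P * P dvd d}"
  let ?C = "{d \<in> ?D. P * P dvd d}"
  have fin: "finite ?D" by (rule finite_subset[OF _ finite_divisors_poly[OF n0]]) auto
  have B: "?B = (*) P ` ?A"
  proof (intro equalityI subsetI)
    fix d assume d: "d \<in> ?B"
    then obtain e where e: "d = P * e" by (auto elim: dvdE)
    with d P0 have "e \<in> ?A" using P by (auto simp: lead_coeff_mult dest: dvd_mult_right)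
    then show "d \<in> (*) P ` ?A" using e by auto
  next
    fix d assume "d \<in> (*) P ` ?A"
    then obtain e where e: "d = P * e" "e \<in> ?A" by auto
    obtain k where k: "n = e * k" using e by (auto elim: dvdE)
    have "P dvd k" using P(3) e(2) prime k by (auto simp: prime_elem_dvd_mult_iff)
    then have "P * e dvd n" using k by (metis mult.commute mult_dvd_mono dvd_refl)
    then show "d \<in> ?B" using e P P0 by (auto simp: lead_coeff_mult)
  qed
  have inj: "inj_on ((*) P) ?A" using P0 by (auto simp: inj_on_def)
  have "sum moebius ?B = (\<Sum>d\<in>?A. moebius (P * d))"
    unfolding B by (subst sum.reindex[OF inj]) simp
  also have "\<dots> = (\<Sum>d\<in>?A. - moebius d)"
    using moebius_mult_irreducible[OF P(1,2)] by (intro sum.cong) auto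
  finally have AB: "sum moebius ?A + sum moebius ?B = 0" by (simp add: sum_negf)
  have "moebius d = 0" if "P * P dvd d" for d
    using that not_squarefreeI[of P d] irreducible_not_unit[OF P(2)]
    by (simp add: moebius_def power2_eq_square)
  then have C: "sum moebius ?C = 0" by (intro sum.neutral) auto
  have fin': "finite ?A" "finite ?B" "finite ?C"
    by (rule finite_subset[OF _ fin], blast)+
  have "?D = ?A \<union> (?B \<union> ?C)" by blast
  then have "sum moebius ?D = sum moebius (?A \<union> (?B \<union> ?C))" by (rule arg_cong)
  also have "\<dots> = sum moebius ?A + sum moebius (?B \<union> ?C)"
  proof (rule sum.union_disjoint)
    show "?A \<inter> (?B \<union> ?C) = {}" using dvd_mult_left[of P P] by blast
  qed (intro fin' finite_UnI)+
  also have "sum moebius (?B \<union> ?C) = sum moebius ?B + sum moebius ?C"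
    by (rule sum.union_disjoint[OF fin'(2,3)]) blast
  finally have "sum moebius ?D = 0" using AB C by linarith
  then show ?thesis using False by simp
qed

text \<open>The common divisors are the divisors of the greatest one, which is \<open>1\<close> exactly when \<open>g\<close> and \<open>f\<close> are coprime.\<close>

lemma sum_moebius_common_divisors:
  fixes f g :: "'a::{finite,field} poly"
  assumes "f \<noteq> 0"
  shows "(\<Sum>e | lead_coeff e = 1 \<and> e dvd f \<and> e dvd g. moebius e) = (if coprime g f then 1 else 0)"
proof -
  let ?n = "monic_gcd g f"
  have n: "lead_coeff ?n = 1" "\<And>e. e dvd ?n \<longleftrightarrow> e dvd g \<and> e dvd f"
    using monic_gcd_properties[OF assms] by auto
  have "coprime g f \<longleftrightarrow> ?n = 1"
  proof
    assume "coprime g f"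
    then have "?n dvd 1" using n(2) by (meson coprime_common_divisor dvd_refl)
    then show "?n = 1" using n(1) monic_dvd_antisym[of ?n 1] by auto
  next
    assume "?n = 1"
    then show "coprime g f" using n(2) by (auto intro: coprimeI)
  qed
  moreover have "{e. lead_coeff e = 1 \<and> e dvd f \<and> e dvd g} = {e. lead_coeff e = 1 \<and> e dvd ?n}"
    using n(2) by auto
  ultimately show ?thesis using sum_moebius_monic_divisors[OF n(1)] by simp
qed

section \<open>Character sums over residue systems\<close>

lemma alpha1_add: "alpha1 (g + h) f = alpha1 g f + alpha1 h f"
  by (simp add: alpha1_def poly_mod_add_left)

text \<open>
  The remainder of \<open>e h\<close> modulo \<open>e d\<close> is \<open>e\<close> times the remainder \<open>r\<close> of \<open>h\<close> modulo \<open>d\<close>. As \<open>e\<close> is monic and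
  \<open>r\<close> has no coefficients beyond the position \<open>degree d - 1\<close>, only one product contributes to the top
  coefficient of \<open>e r\<close>.
\<close>

lemma alpha1_cancel:
  fixes d e h :: "'a::field poly"
  assumes "lead_coeff e = 1" "lead_coeff d = 1"
  shows "alpha1 (e * h) (e * d) = alpha1 h d"
proof -
  have e0: "e \<noteq> 0" and d0: "d \<noteq> 0" using assms by auto
  have mod: "(e * h) mod (e * d) = e * (h mod d)" by (rule mult_mod_right[symmetric])
  show ?thesis
  proof (cases "h mod d = 0")
    case False
    \<comment> \<open>A nonzero remainder forces \<open>degree d > 0\<close>, so the subtraction in \<open>degree d - 1\<close> does not truncate.\<close>
    define r where "r = h mod d"
    have deg: "degree r < degree d" using degree_mod_less'[OF d0 False] by (simp add: r_def)
    define m where "m = degree d - 1"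
    have idx: "degree (e * d) - 1 = degree e + m"
      using deg e0 d0 by (simp add: degree_mult_eq m_def)
    have "coeff (e * r) (degree e + m) = (\<Sum>i\<le>degree e + m. coeff e i * coeff r (degree e + m - i))"
      by (rule coeff_mult)
    also have "\<dots> = (\<Sum>i\<in>{degree e}. coeff e i * coeff r (degree e + m - i))"
    proof (rule sum.mono_neutral_right)
      show "\<forall>i\<in>{..degree e + m} - {degree e}. coeff e i * coeff r (degree e + m - i) = 0"
      proof
        fix i assume i: "i \<in> {..degree e + m} - {degree e}"
        show "coeff e i * coeff r (degree e + m - i) = 0"
        proof (cases "i < degree e")
          case True
          then have "degree r < degree e + m - i" using deg by (simp add: m_def)
          then show ?thesis by (simp add: coeff_eq_0)
        next
          case False
          then show ?thesis using i by (simp add: coeff_eq_0)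
        qed
      qed
    qed auto
    finally have "coeff (e * r) (degree e + m) = coeff r m" using assms(1) by simp
    then show ?thesis unfolding alpha1_def mod idx r_def m_def .
  qed (simp add: alpha1_def mod)
qed

text \<open>Without \<open>zero\<close> the constant function \<open>0\<close> would satisfy the other two conditions.\<close>

locale nontrivial_additive_character =
  fixes \<psi> :: "'a::{finite,field} \<Rightarrow> complex"
  assumes zero [simp]: "\<psi> 0 = 1"
    and add: "\<psi> (x + y) = \<psi> x * \<psi> y"
    and nontrivial: "\<exists>c. \<psi> c \<noteq> 1"
begin

lemma exists_residue_nontrivial:
  fixes f h :: "'a poly"
  assumes "lead_coeff f = 1" "\<not> f dvd h"
  obtains g where "g mod f = g" "\<psi> (alpha1 (h * g) f) \<noteq> 1"
proof -
  have f0: "f \<noteq> 0" using assms by auto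
  define r where "r = h mod f"
  have r0: "r \<noteq> 0" using assms by (simp add: r_def dvd_eq_mod_eq_0)
  have deg: "degree r < degree f" using degree_mod_less'[OF f0] r0 by (simp add: r_def)
  obtain c where c: "\<psi> c \<noteq> 1" using nontrivial by blast
  then have c0: "c \<noteq> 0" by auto
  \<comment> \<open>This monomial lifts the leading term of \<open>r\<close> to the top position \<open>degree f - 1\<close> and turns its coefficient
      into \<open>c\<close>; no reduction modulo \<open>f\<close> takes place.\<close>
  define m where "m = degree f - 1 - degree r"
  define g where "g = monom (c / lead_coeff r) m"
  have coeff: "coeff (r * g) (degree f - 1) = c" "\<And>i. i \<ge> degree f \<Longrightarrow> coeff (r * g) i = 0"
    using deg r0 by (auto simp: g_def m_def coeff_eq_0 mult.commute[of r] coeff_monom_mult)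
  have "(h * g) mod f = (r * g) mod f" by (simp add: r_def mod_mult_left_eq)
  also have "\<dots> = r * g" using coeff(2) by (simp add: reduced_iff_coeff[OF f0])
  finally have "alpha1 (h * g) f = c" using coeff by (simp add: alpha1_def)
  moreover have "g mod f = g"
    using deg by (auto simp: reduced_iff_coeff[OF f0] g_def m_def)
  ultimately show ?thesis using that c by blast
qed

text \<open>Orthogonality: translation by a residue on which the character is not \<open>1\<close> multiplies the sum by that value.\<close>

lemma sum_residues:
  fixes f h :: "'a poly"
  assumes "lead_coeff f = 1"
  shows "(\<Sum>g | g mod f = g. \<psi> (alpha1 (h * g) f)) = (if f dvd h then of_nat (poly_abs f) else 0)"
proof (cases "f dvd h")
  case True
  then have "\<psi> (alpha1 (h * g) f) = 1" for g by (simp add: alpha1_def)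
  then show ?thesis using True card_residues[of f] assms by (auto simp: monic_imp_nonzero)
next
  case False
  let ?R = "{g. g mod f = g}"
  let ?S = "\<Sum>g\<in>?R. \<psi> (alpha1 (h * g) f)"
  obtain g0 where g0: "g0 mod f = g0" "\<psi> (alpha1 (h * g0) f) \<noteq> 1"
    using exists_residue_nontrivial[OF assms False] .
  have "?S = (\<Sum>g\<in>?R. \<psi> (alpha1 (h * (g + g0)) f))"
    by (rule sum.reindex_bij_witness[of _ "\<lambda>g. g + g0" "\<lambda>g. g - g0"])
       (auto simp: g0 poly_mod_add_left poly_mod_diff_left)
  also have "\<dots> = ?S * \<psi> (alpha1 (h * g0) f)"
    by (simp add: distrib_left alpha1_add add sum_distrib_right)
  finally have "?S = 0" using g0(2) by simp
  then show ?thesis using False by simp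
qed

text \<open>The residues modulo \<open>e d\<close> that are multiples of \<open>e\<close> are the \<open>e g\<close> with \<open>g\<close> reduced modulo \<open>d\<close>.\<close>

lemma sum_residues_multiples:
  fixes d e h :: "'a poly"
  assumes "lead_coeff e = 1" "lead_coeff d = 1"
  shows "(\<Sum>g | g mod (e * d) = g \<and> e dvd g. \<psi> (alpha1 (h * g) (e * d))) =
    (if d dvd h then of_nat (poly_abs d) else 0)"
proof -
  have e0: "e \<noteq> 0" using assms by auto
  have eq: "{g. g mod (e * d) = g \<and> e dvd g} = (*) e ` {g. g mod d = g}"
    using e0 by (auto simp: mult_mod_right[symmetric] elim!: dvdE)
  have inj: "inj_on ((*) e) {g. g mod d = g}" using e0 by (auto simp: inj_on_def)
  have "(\<Sum>g | g mod (e * d) = g \<and> e dvd g. \<psi> (alpha1 (h * g) (e * d))) =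
        (\<Sum>g | g mod d = g. \<psi> (alpha1 (h * (e * g)) (e * d)))"
    unfolding eq by (subst sum.reindex[OF inj]) simp
  also have "\<dots> = (\<Sum>g | g mod d = g. \<psi> (alpha1 (h * g) d))"
    by (simp add: mult.left_commute[of h e] alpha1_cancel[OF assms])
  finally show ?thesis using sum_residues[OF assms(2)] by simp
qed

text \<open>Ramanujan's formula for an arbitrary nontrivial additive character of the coefficient field.\<close>

theorem sum_coprime_residues:
  fixes f h :: "'a poly"
  assumes f: "lead_coeff f = 1"
  shows "(\<Sum>g | g mod f = g \<and> coprime g f. \<psi> (alpha1 (h * g) f)) =
    (\<Sum>d | lead_coeff d = 1 \<and> d dvd h \<and> d dvd f. of_nat (poly_abs d) * of_int (moebius (f div d)))"
proof -
  have f0: "f \<noteq> 0" using f by auto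
  let ?R = "{g. g mod f = g}"
  let ?D = "{d. lead_coeff d = 1 \<and> d dvd f}"
  let ?E = "\<lambda>g. \<psi> (alpha1 (h * g) f)"
  have finR: "finite ?R" using card_residues[OF f0] by simp
  have finD: "finite ?D" by (rule finite_subset[OF _ finite_divisors_poly[OF f0]]) auto
  have cofactor: "lead_coeff (f div d) = 1" "f div d dvd f" "f div (f div d) = d" "(f div d) * d = f"
    if d: "d \<in> ?D" for d
  proof -
    obtain k where k: "f = d * k" using d by (auto elim: dvdE)
    have "d \<noteq> 0" "k \<noteq> 0" using f0 k by auto
    then show "lead_coeff (f div d) = 1" "f div d dvd f" "f div (f div d) = d" "(f div d) * d = f"
      using k monic_cofactor[of d k] f d by auto
  qed
  have "(\<Sum>g | g mod f = g \<and> coprime g f. ?E g) = (\<Sum>g\<in>?R. if coprime g f then ?E g else 0)"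
    using finR by (simp add: sum.inter_filter[symmetric])
  also have "\<dots> = (\<Sum>g\<in>?R. \<Sum>e | e \<in> ?D \<and> e dvd g. of_int (moebius e) * ?E g)"
  proof (rule sum.cong)
    fix g
    have "(\<Sum>e | e \<in> ?D \<and> e dvd g. of_int (moebius e) * ?E g) =
          of_int (\<Sum>e | lead_coeff e = 1 \<and> e dvd f \<and> e dvd g. moebius e) * ?E g"
      by (simp add: sum_distrib_right conj_assoc)
    then show "(if coprime g f then ?E g else 0) =
      (\<Sum>e | e \<in> ?D \<and> e dvd g. of_int (moebius e) * ?E g)"
      using sum_moebius_common_divisors[OF f0, of g] by simp
  qed simp
  also have "\<dots> = (\<Sum>e\<in>?D. \<Sum>g | g \<in> ?R \<and> e dvd g. of_int (moebius e) * ?E g)"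
    by (rule sum.swap_restrict[OF finR finD])
  also have "\<dots> = (\<Sum>e\<in>?D. of_int (moebius e) * (\<Sum>g | g mod f = g \<and> e dvd g. ?E g))"
    by (simp add: sum_distrib_left)
  \<comment> \<open>Passing to the complementary divisor is an involution of the monic divisors of \<open>f\<close>.\<close>
  also have "\<dots> = (\<Sum>d\<in>?D. of_int (moebius (f div d)) * (\<Sum>g | g mod f = g \<and> f div d dvd g. ?E g))"
    by (rule sum.reindex_bij_witness[of _ "\<lambda>d. f div d" "\<lambda>d. f div d"]) (use cofactor in auto)
  also have "\<dots> = (\<Sum>d\<in>?D. if d dvd h then of_nat (poly_abs d) * of_int (moebius (f div d)) else 0)"
  proof (rule sum.cong)
    fix d assume d: "d \<in> ?D"
    show "of_int (moebius (f div d)) * (\<Sum>g | g mod f = g \<and> f div d dvd g. ?E g) =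
      (if d dvd h then of_nat (poly_abs d) * of_int (moebius (f div d)) else 0)"
      using sum_residues_multiples[of "f div d" d h] d cofactor[OF d] by simp
  qed simp
  also have "\<dots> = (\<Sum>d | d \<in> ?D \<and> d dvd h. of_nat (poly_abs d) * of_int (moebius (f div d)))"
    using finD by (simp add: sum.inter_filter[symmetric])
  also have "{d. d \<in> ?D \<and> d dvd h} = {d. lead_coeff d = 1 \<and> d dvd h \<and> d dvd f}" by auto
  finally show ?thesis .
qed

end

section \<open>The prime field\<close>

lemma CHAR_eq_of_card:
  assumes "prime p" "CARD('a::{finite,field}) = p ^ t"
  shows "CHAR('a) = p"
proof -
  have "prime CHAR('a)"
    by (intro prime_CHAR_semidom finite_imp_CHAR_pos) simp
  moreover have "CHAR('a) dvd p ^ t"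
  proof -
    \<comment> \<open>Translation by \<open>1\<close> permutes the field, so the sum of all elements shows that \<open>q \<cdot> 1 = 0\<close>.\<close>
    have "(\<Sum>x\<in>UNIV. x) = (\<Sum>x\<in>UNIV. x + 1 :: 'a)"
      by (rule sum.reindex_bij_witness[of _ "\<lambda>x. x + 1" "\<lambda>x. x - 1"]) auto
    then have "of_nat CARD('a) = (0 :: 'a)" by (simp add: sum.distrib)
    then show ?thesis unfolding assms(2) of_nat_eq_0_iff_char_dvd .
  qed
  ultimately show ?thesis using assms(1) prime_dvd_power primes_dvd_imp_eq by blast
qed

lemma prime_field_closed:
  "0 \<in> (prime_field :: 'a::field set)" "1 \<in> (prime_field :: 'a::field set)"
  "x \<in> prime_field \<Longrightarrow> y \<in> prime_field \<Longrightarrow> x + y \<in> (prime_field :: 'a::field set)"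
  "x \<in> prime_field \<Longrightarrow> y \<in> prime_field \<Longrightarrow> x * y \<in> (prime_field :: 'a::field set)"
  "x \<in> prime_field \<Longrightarrow> y \<in> prime_field \<Longrightarrow> x - y \<in> (prime_field :: 'a::field set)"
  unfolding prime_field_def Ints_def[symmetric] by auto

lemma prime_field_sum:
  "(\<And>i. i \<in> I \<Longrightarrow> c i \<in> prime_field) \<Longrightarrow> sum c I \<in> (prime_field :: 'a::field set)"
  unfolding prime_field_def Ints_def[symmetric] by auto

lemma bij_betw_prime_field:
  assumes "CHAR('a::field) = p" "p > 0"
  shows "bij_betw (of_int :: int \<Rightarrow> 'a) {0..<int p} prime_field"
proof (rule bij_betwI')
  fix x y assume "x \<in> {0..<int p}" "y \<in> {0..<int p}"
  then show "((of_int x :: 'a) = of_int y) = (x = y)"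
    by (simp add: of_int_eq_iff_cong_CHAR assms cong_def)
next
  fix y :: 'a assume "y \<in> prime_field"
  then obtain k where "y = of_int k" by (auto simp: prime_field_def)
  then have "y = of_int (k mod int p)" by (simp add: of_int_eq_iff_cong_CHAR assms)
  then show "\<exists>x\<in>{0..<int p}. y = of_int x" using assms(2) by (intro bexI[of _ "k mod int p"]) auto
qed (auto simp: prime_field_def)

lemma card_prime_field:
  assumes "CHAR('a::field) = p" "p > 0"
  shows "card (prime_field :: 'a set) = p"
  using bij_betw_same_card[OF bij_betw_prime_field[OF assms]] by simp

lemma int_rep_of_int:
  assumes "CHAR('a::field) = p" "p > 0"
  shows "int_rep p (of_int k :: 'a) = k mod int p"
  unfolding int_rep_def
proof (rule the_equality)
  show "0 \<le> k mod int p \<and> k mod int p < int p \<and> (of_int (k mod int p) :: 'a) = of_int k"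
    using assms(2) by (simp add: of_int_eq_iff_cong_CHAR assms)
qed (auto simp: of_int_eq_iff_cong_CHAR assms cong_def)

text \<open>
  By periodicity the representative in \<open>{0..<p}\<close> may be replaced by any integer with the same image in
  the prime field. This is what makes the exponential additive, although \<^const>\<open>int_rep\<close> is not.
\<close>

lemma exp_int_rep_of_int:
  assumes "CHAR('a::field) = p" "p > 0"
  shows "exp (2 * of_real pi * \<i> * of_int (int_rep p (of_int k :: 'a)) / of_nat p) = cis (2 * pi * of_int k / of_nat p)"
proof -
  define m where "m = k div int p"
  have "k = m * int p + k mod int p" by (simp add: m_def)
  then have "real_of_int k = of_int m * real p + of_int (k mod int p)"
    by (metis of_int_add of_int_mult of_int_of_nat_eq)
  then have eq: "2 * pi * of_int k / of_nat p = 2 * pi * of_int m + 2 * pi * of_int (k mod int p) / of_nat p"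
    using assms(2) by (simp add: field_simps)
  have "cis (2 * pi * of_int k / of_nat p) =
      cis (2 * pi * of_int m) * cis (2 * pi * of_int (k mod int p) / of_nat p)"
    unfolding eq by (rule cis_mult[symmetric])
  also have "cis (2 * pi * of_int m) = 1" by (rule cis_multiple_2pi) simp
  finally show ?thesis by (simp add: int_rep_of_int[OF assms] cis_conv_exp mult_ac)
qed

lemma nontrivial_additive_character_of_coordinate:
  fixes L :: "'a::{finite,field} \<Rightarrow> 'a"
  assumes p: "prime p" "CHAR('a) = p"
    and L: "\<And>x. L x \<in> prime_field" "\<And>x y. L (x + y) = L x + L y" "L b = 1"
  shows "nontrivial_additive_character
    (\<lambda>x. exp (2 * of_real pi * \<i> * of_int (int_rep p (L x)) / of_nat p))"
proof -
  have p0: "p > 0" using p prime_gt_0_nat by blast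
  note E = exp_int_rep_of_int[OF p(2) p0]
  let ?\<chi> = "\<lambda>x::'a. exp (2 * of_real pi * \<i> * of_int (int_rep p x) / of_nat p)"
  have add: "?\<chi> (x + y) = ?\<chi> x * ?\<chi> y" if xy: "x \<in> prime_field" "y \<in> prime_field" for x y
  proof -
    obtain k l where kl: "x = of_int k" "y = of_int l" using xy by (auto simp: prime_field_def)
    show ?thesis
      unfolding kl of_int_add[symmetric] E cis_mult
      by (simp add: add_divide_distrib distrib_left)
  qed
  have "L 0 + L 0 = L 0 + 0" using L(2)[of 0 0] by (simp only: add_0_right)
  then have "L 0 = 0" by (simp only: add_left_cancel)
  then have zero: "?\<chi> (L 0) = 1" using E[of 0] by simp
  have "2 \<le> p" using p prime_ge_2_nat by blast
  then have "cos (2 * pi / of_nat p) < cos 0"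
    by (intro cos_monotone_0_pi) (auto simp: field_simps)
  then have "cis (2 * pi / of_nat p) \<noteq> 1" by (auto simp: complex_eq_iff)
  then have nontrivial: "?\<chi> (L b) \<noteq> 1" using E[of 1] by (simp add: L)
  show ?thesis
  proof
    show "?\<chi> (L 0) = 1" by (rule zero)
    show "?\<chi> (L (x + y)) = ?\<chi> (L x) * ?\<chi> (L y)" for x y
      unfolding L(2) by (rule add[OF L(1) L(1)])
    show "\<exists>c. ?\<chi> (L c) \<noteq> 1" using nontrivial by (rule exI)
  qed
qed

section \<open>Coordinates in the basis of powers of \<open>\<theta>\<close>\<close>

lemma prime_field_polys_mult:
  "P \<in> prime_field_polys \<Longrightarrow> Q \<in> prime_field_polys \<Longrightarrow> P * Q \<in> prime_field_polys"
  unfolding prime_field_polys_def by (auto simp: coeff_mult intro!: prime_field_sum prime_field_closed)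

lemma prime_field_polys_power:
  "P \<in> prime_field_polys \<Longrightarrow> P ^ n \<in> prime_field_polys"
proof (induction n)
  case 0
  show ?case by (auto simp: prime_field_polys_def prime_field_closed)
qed (auto intro: prime_field_polys_mult)

text \<open>Two powers of \<open>x\<close> coincide by finiteness, so some positive power of \<open>x\<close> is \<open>1\<close>.\<close>

lemma inverse_eq_power_finite_field:
  fixes x :: "'a::{finite,field}"
  assumes "x \<noteq> 0"
  obtains n where "inverse x = x ^ n"
proof -
  have "\<not> inj (\<lambda>n::nat. x ^ n)"
    using finite_imageD[of "\<lambda>n::nat. x ^ n" UNIV] by auto
  then obtain m k :: nat where mk: "x ^ m = x ^ k" "m < k"
    by (metis injI linorder_neqE_nat)
  have "x ^ m * (x * x ^ (k - m - 1)) = x ^ (m + Suc (k - m - 1))"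
    by (simp only: power_add power_Suc)
  also have "m + Suc (k - m - 1) = k" using mk(2) by simp
  finally have "x ^ m * (x * x ^ (k - m - 1)) = x ^ m * 1" using mk(1) by simp
  then have "x * x ^ (k - m - 1) = 1" using assms by simp
  then show ?thesis using that inverse_unique by blast
qed

text \<open>
  Division by \<open>\<Psi>\<close> that keeps track of the coefficients staying in the prime field. The induction is
  Horner's scheme: multiplication by \<open>X\<close> raises a reduced polynomial to degree at most \<open>degree \<Psi>\<close>, and
  a single multiple of the monic \<open>\<Psi>\<close> brings it down again.
\<close>

lemma reduce_modulo_monic:
  fixes P \<Psi> :: "'a::field poly"
  assumes \<Psi>: "\<Psi> \<in> prime_field_polys" "lead_coeff \<Psi> = 1" "poly \<Psi> \<theta> = 0"
    and P: "P \<in> prime_field_polys"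
  shows "\<exists>r\<in>prime_field_polys. (\<forall>i\<ge>degree \<Psi>. coeff r i = 0) \<and> poly r \<theta> = poly P \<theta>"
  using P
proof (induction P)
  case 0
  then show ?case by (intro bexI[of _ 0]) auto
next
  case (pCons a P)
  have a: "a \<in> prime_field" and "P \<in> prime_field_polys"
    using pCons.prems unfolding prime_field_polys_def
    by (auto dest: spec[of _ 0] spec[of _ "Suc _"])
  then obtain r where r: "r \<in> prime_field_polys" "\<forall>i\<ge>degree \<Psi>. coeff r i = 0" "poly r \<theta> = poly P \<theta>"
    using pCons.IH by blast
  define s where "s = pCons a r"
  have s: "coeff s i \<in> prime_field" for i
    using r(1) a by (auto simp: s_def prime_field_polys_def coeff_pCons split: nat.split)
  define r' where "r' = s - smult (coeff s (degree \<Psi>)) \<Psi>"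
  have "r' \<in> prime_field_polys"
    using s \<Psi>(1) by (auto simp: r'_def prime_field_polys_def intro!: prime_field_closed)
  moreover have "coeff r' i = 0" if "i \<ge> degree \<Psi>" for i
  proof (cases "i = degree \<Psi>")
    case True
    then show ?thesis using \<Psi>(2) by (simp add: r'_def)
  next
    case False
    then show ?thesis using that r(2)
      by (auto simp: r'_def s_def coeff_eq_0 coeff_pCons split: nat.split)
  qed
  moreover have "poly r' \<theta> = poly (pCons a P) \<theta>" using \<Psi>(3) r(3) by (simp add: r'_def s_def)
  ultimately show ?case by blast
qed

text \<open>
  A quotient of polynomials in \<open>\<theta>\<close> is a polynomial in \<open>\<theta>\<close>, since the inverse of the denominator is one
  of its powers; reduction modulo \<open>\<Psi>\<close> then leaves powers below \<open>t\<close>.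
\<close>

lemma theta_powers_span:
  fixes \<theta> :: "'a::{finite,field}"
  assumes "presentation t \<theta> \<Psi>"
  obtains a where "\<forall>i\<in>{1..t}. a i \<in> prime_field" "\<alpha> = (\<Sum>i=1..t. a i * \<theta> ^ (t - i))"
proof -
  have \<Psi>: "\<Psi> \<in> prime_field_polys" "lead_coeff \<Psi> = 1" "poly \<Psi> \<theta> = 0" "degree \<Psi> = t"
    and adj: "\<alpha> \<in> prime_field_adjoin \<theta>"
    using assms by (auto simp: presentation_def irreducible_in_def)
  obtain P Q where PQ: "P \<in> prime_field_polys" "Q \<in> prime_field_polys" "poly Q \<theta> \<noteq> 0"
      "\<alpha> = poly P \<theta> / poly Q \<theta>"
    using adj by (auto simp: prime_field_adjoin_def)
  obtain n where "inverse (poly Q \<theta>) = poly Q \<theta> ^ n"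
    using inverse_eq_power_finite_field[OF PQ(3)] .
  then have "\<alpha> = poly (P * Q ^ n) \<theta>" by (simp add: PQ(4) field_class.field_divide_inverse)
  moreover have "P * Q ^ n \<in> prime_field_polys"
    using PQ by (intro prime_field_polys_mult prime_field_polys_power)
  ultimately obtain r where r: "r \<in> prime_field_polys" "\<forall>i\<ge>t. coeff r i = 0" "\<alpha> = poly r \<theta>"
    using reduce_modulo_monic[OF \<Psi>(1-3), of "P * Q ^ n"] \<Psi>(4) by metis
  have "poly r \<theta> = (\<Sum>i\<le>degree r. coeff r i * \<theta> ^ i)" by (rule poly_altdef)
  also have "\<dots> = (\<Sum>i<t. coeff r i * \<theta> ^ i)"
  proof (rule sum.mono_neutral_cong)
    show "coeff r i * \<theta> ^ i = 0" if "i \<in> {..<t} - {..degree r}" for i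
      using that by (simp add: coeff_eq_0)
    show "coeff r i * \<theta> ^ i = 0" if "i \<in> {..degree r} - {..<t}" for i
      using that r(2) by simp
  qed auto
  also have "\<dots> = (\<Sum>i=1..t. coeff r (t - i) * \<theta> ^ (t - i))"
    by (rule sum.reindex_bij_witness[of _ "\<lambda>i. t - i" "\<lambda>i. t - i"]) auto
  finally have "\<alpha> = (\<Sum>i=1..t. coeff r (t - i) * \<theta> ^ (t - i))" using r(3) by simp
  then show ?thesis using that[of "\<lambda>i. coeff r (t - i)"] r(1) by (auto simp: prime_field_polys_def)
qed

text \<open>
  Linear independence by counting: the coefficient vectors map onto the field and are as many as its
  elements.
\<close>

lemma theta_powers_independent:
  fixes \<theta> :: "'a::{finite,field}"
  assumes pres: "presentation t \<theta> \<Psi>" and card: "CARD('a) = card (prime_field :: 'a set) ^ t"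
  shows "inj_on (\<lambda>a. \<Sum>i=1..t. a i * \<theta> ^ (t - i)) (PiE {1..t} (\<lambda>_. prime_field))"
proof (rule eq_card_imp_inj_on)
  let ?F = "\<lambda>a. \<Sum>i=1..t. a i * \<theta> ^ (t - i)"
  let ?X = "PiE {1..t} (\<lambda>_. prime_field :: 'a set)"
  show "finite ?X" by (intro finite_PiE) auto
  have "\<alpha> \<in> ?F ` ?X" for \<alpha>
  proof -
    obtain a where a: "\<forall>i\<in>{1..t}. a i \<in> prime_field" "\<alpha> = ?F a"
      using theta_powers_span[OF pres] .
    then have "\<alpha> = ?F (restrict a {1..t})" by simp
    moreover have "restrict a {1..t} \<in> ?X" using a(1) by auto
    ultimately show ?thesis by (rule image_eqI)
  qed
  then have "?F ` ?X = UNIV" by blast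
  then show "card (?F ` ?X) = card ?X" by (simp add: card card_PiE)
qed

lemma theta_coord_eqI:
  fixes \<theta> :: "'a::{finite,field}"
  assumes pres: "presentation t \<theta> \<Psi>" and card: "CARD('a) = card (prime_field :: 'a set) ^ t"
    and t: "t \<ge> 1" and a: "\<forall>i\<in>{1..t}. a i \<in> prime_field"
  shows "theta_coord t \<theta> (\<Sum>i=1..t. a i * \<theta> ^ (t - i)) = a 1"
  unfolding theta_coord_def
proof (rule the_equality)
  let ?F = "\<lambda>a. \<Sum>i=1..t. a i * \<theta> ^ (t - i)"
  fix x assume "\<exists>b. (\<forall>i\<in>{1..t}. b i \<in> prime_field) \<and> ?F a = ?F b \<and> x = b 1"
  then obtain b where b: "\<forall>i\<in>{1..t}. b i \<in> prime_field" "?F a = ?F b" "x = b 1" by blast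
  have "?F (restrict a {1..t}) = ?F (restrict b {1..t})" using b(2) by simp
  moreover have "restrict a {1..t} \<in> PiE {1..t} (\<lambda>_. prime_field)"
      "restrict b {1..t} \<in> PiE {1..t} (\<lambda>_. prime_field)"
    using a b(1) by auto
  ultimately have "restrict a {1..t} = restrict b {1..t}"
    using theta_powers_independent[OF pres card] by (rule inj_onD[rotated])
  then have "restrict a {1..t} 1 = restrict b {1..t} 1" by simp
  then show "x = a 1" using b(3) t by simp
qed (use a in blast)

lemma theta_coord_linear:
  fixes \<theta> :: "'a::{finite,field}"
  assumes pres: "presentation t \<theta> \<Psi>" and card: "CARD('a) = card (prime_field :: 'a set) ^ t"
    and t: "t \<ge> 1"
  shows theta_coord_in_prime_field: "theta_coord t \<theta> x \<in> prime_field"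
    and theta_coord_add: "theta_coord t \<theta> (x + y) = theta_coord t \<theta> x + theta_coord t \<theta> y"
    and theta_coord_power: "theta_coord t \<theta> (\<theta> ^ (t - 1)) = 1"
proof -
  note eqI = theta_coord_eqI[OF pres card t]
  obtain a where a: "\<forall>i\<in>{1..t}. a i \<in> prime_field" "x = (\<Sum>i=1..t. a i * \<theta> ^ (t - i))"
    using theta_powers_span[OF pres] .
  obtain b where b: "\<forall>i\<in>{1..t}. b i \<in> prime_field" "y = (\<Sum>i=1..t. b i * \<theta> ^ (t - i))"
    using theta_powers_span[OF pres] .
  show "theta_coord t \<theta> x \<in> prime_field" using eqI[OF a(1)] a t by simp
  have "x + y = (\<Sum>i=1..t. (a i + b i) * \<theta> ^ (t - i))"
    by (simp add: a(2) b(2) distrib_right sum.distrib)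
  moreover have "\<forall>i\<in>{1..t}. a i + b i \<in> prime_field" using a b prime_field_closed by blast
  ultimately show "theta_coord t \<theta> (x + y) = theta_coord t \<theta> x + theta_coord t \<theta> y"
    using eqI[of "\<lambda>i. a i + b i"] eqI[OF a(1)] eqI[OF b(1)] a(2) b(2) by simp
  let ?e = "\<lambda>i. if i = 1 then 1 else 0 :: 'a"
  have "(\<Sum>i=1..t. ?e i * \<theta> ^ (t - i)) = (\<Sum>i=1..t. if i = 1 then \<theta> ^ (t - 1) else 0)"
    by (intro sum.cong) auto
  also have "\<dots> = \<theta> ^ (t - 1)" using t by simp
  finally have "(\<Sum>i=1..t. ?e i * \<theta> ^ (t - i)) = \<theta> ^ (t - 1)" .
  moreover have "\<forall>i\<in>{1..t}. ?e i \<in> prime_field" using prime_field_closed(1,2) by (metis (full_types))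
  ultimately show "theta_coord t \<theta> (\<theta> ^ (t - 1)) = 1" using eqI[of ?e] by simp
qed

section \<open>The Ramanujan sum\<close>

theorem theorem3p1:
  fixes p t :: nat and \<theta> :: "'a::{finite,field}" and \<Psi> h f :: "'a poly"
  assumes "prime p" and "t \<ge> 1" and "CARD('a) = p ^ t"
    and "t > 1 \<longrightarrow> presentation t \<theta> \<Psi>"
    and "lead_coeff h = 1" and "lead_coeff f = 1"
  shows "eta p t \<theta> h f =
    (\<Sum>d | lead_coeff d = 1 \<and> d dvd monic_gcd h f. of_nat (poly_abs d) * of_int (moebius (f div d)))"
proof -
  have char: "CHAR('a) = p" using assms CHAR_eq_of_card by blast
  have card: "card (prime_field :: 'a set) = p"
    using card_prime_field[OF char] assms(1) prime_gt_0_nat by blast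
  \<comment> \<open>For \<open>t = 1\<close> the field is its own prime field and the coordinate is the element itself.\<close>
  define L where "L x = (if t = 1 then x else theta_coord t \<theta> x)" for x
  have "(\<forall>x. L x \<in> prime_field) \<and> (\<forall>x y. L (x + y) = L x + L y) \<and> (\<exists>b. L b = 1)"
  proof (cases "t = 1")
    case True
    then have "(prime_field :: 'a set) = UNIV"
      using card assms(3) by (intro card_subset_eq) auto
    then show ?thesis using True by (auto simp: L_def)
  next
    case False
    then have "presentation t \<theta> \<Psi>" "CARD('a) = card (prime_field :: 'a set) ^ t"
      using assms card by auto
    from theta_coord_linear[OF this assms(2)] show ?thesis
      using False by (auto simp: L_def)
  qed
  then obtain b where L: "\<And>x. L x \<in> prime_field" "\<And>x y. L (x + y) = L x + L y" "L b = 1"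
    by blast
  interpret nontrivial_additive_character
      "\<lambda>x. exp (2 * of_real pi * \<i> * of_int (int_rep p (L x)) / of_nat p)"
    using nontrivial_additive_character_of_coordinate[OF assms(1) char L] .
  have f0: "f \<noteq> 0" using assms by auto
  have "eta p t \<theta> h f = (\<Sum>g | g mod f = g \<and> coprime g f.
      exp (2 * of_real pi * \<i> * of_int (int_rep p (L (alpha1 (h * g) f))) / of_nat p))"
    by (simp add: eta_def eps_def L_def Let_def)
  then show ?thesis
    unfolding sum_coprime_residues[OF assms(6)] dvd_monic_gcd_iff[OF f0] .
qed

end
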